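(* Let $G$ be a simple connected graph with adjacency matrix $A$ and let $k$ be a positive integer. Then $$\alpha_k(G)=\alpha(G^k)\le\Theta(G^k)\le \min_{\substack{p\in\mathbb R_k[x]\\ (p(A))_{ii}\neq 0\ \forall i}}\operatorname{rank}(p(A)).$$
   Context: $\mathbb R_k[x]$ is the set of real polynomials of degree at most $k$. $G^k$ has the vertex set of $G$, two distinct vertices adjacent iff their distance in $G$ is at most $k$. $\alpha$ is the independence number; $\alpha_k(G)$ is the maximum number of vertices pairwise at distance greater than $k$ in $G$. $\Theta(H)=\sup_m\alpha(H^{\boxtimes m})^{1/m}$ is the Shannon capacity, with $H^{\boxtimes m}$ the $m$-fold strong product. *)

theory Defs
  imports
    "HOL-Analysis.Analysis"
    "HOL-Computational_Algebra.Polynomial"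
    "Graph_Theory.Graph_Theory"
begin

text \<open>
  A finite simple graph is a \<open>pair_graph\<close>: a finite, loop-free, symmetric set of vertex pairs.
\<close>

definition graph_dist :: "'a pair_pre_digraph \<Rightarrow> 'a \<Rightarrow> 'a \<Rightarrow> ereal" where
  "graph_dist G u v = wf_digraph.\<mu> (with_proj G) (\<lambda>_. 1) u v"

definition graph_power :: "'a pair_pre_digraph \<Rightarrow> nat \<Rightarrow> 'a pair_pre_digraph" where
  "graph_power G k = \<lparr> pverts = pverts G,
     parcs = {(u, v). u \<in> pverts G \<and> v \<in> pverts G \<and> u \<noteq> v \<and> graph_dist G u v \<le> ereal (real k)} \<rparr>"

definition independent_set :: "'a pair_pre_digraph \<Rightarrow> 'a set \<Rightarrow> bool" where
  "independent_set G S \<longleftrightarrow> S \<subseteq> pverts G \<and> (\<forall>u\<in>S. \<forall>v\<in>S. u \<noteq> v \<longrightarrow> (u, v) \<notin> parcs G)"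

definition independence_number :: "'a pair_pre_digraph \<Rightarrow> nat" where
  "independence_number G = (MAX S\<in>{S. independent_set G S}. card S)"

definition k_independent_set :: "nat \<Rightarrow> 'a pair_pre_digraph \<Rightarrow> 'a set \<Rightarrow> bool" where
  "k_independent_set k G S \<longleftrightarrow>
     S \<subseteq> pverts G \<and> (\<forall>u\<in>S. \<forall>v\<in>S. u \<noteq> v \<longrightarrow> graph_dist G u v > ereal (real k))"

definition k_independence_number :: "nat \<Rightarrow> 'a pair_pre_digraph \<Rightarrow> nat" where
  "k_independence_number k G = (MAX S\<in>{S. k_independent_set k G S}. card S)"

text \<open>
  The vertices of the \<open>m\<close>-fold strong product are the words of length \<open>m\<close> over the vertices.
\<close>

definition strong_power :: "'a pair_pre_digraph \<Rightarrow> nat \<Rightarrow> 'a list pair_pre_digraph" where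
  "strong_power H m =
     (let V = {xs. length xs = m \<and> set xs \<subseteq> pverts H} in
      \<lparr> pverts = V,
        parcs = {(xs, ys). xs \<in> V \<and> ys \<in> V \<and> xs \<noteq> ys \<and>
                   (\<forall>i<m. xs ! i = ys ! i \<or> (xs ! i, ys ! i) \<in> parcs H)} \<rparr>)"

definition shannon_capacity :: "'a pair_pre_digraph \<Rightarrow> real" where
  "shannon_capacity H = (SUP m\<in>{1..}. root m (real (independence_number (strong_power H m))))"

definition adjacency_matrix :: "'n::finite pair_pre_digraph \<Rightarrow> real^'n^'n" where
  "adjacency_matrix G = (\<chi> i j. if (i, j) \<in> parcs G then 1 else 0)"

text \<open>
  The operations \<open>*\<close> and \<open>^\<close> on \<open>real^'n^'n\<close> are componentwise, hence the separate matrix power.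
\<close>

primrec matrix_power :: "real^'n^'n \<Rightarrow> nat \<Rightarrow> real^'n^'n" where
  "matrix_power A 0 = mat 1"
| "matrix_power A (Suc i) = A ** matrix_power A i"

definition poly_matrix :: "real poly \<Rightarrow> real^'n^'n \<Rightarrow> real^'n^'n" where
  "poly_matrix p A = (\<Sum>i\<le>degree p. coeff p i *\<^sub>R matrix_power A i)"


text \<open>
  The maxima, the supremum and the minimum in the statement range over nonempty sets that are
  finite, respectively bounded, so \<open>Max\<close>, \<open>Sup\<close> and \<open>Min\<close> have their intended values.
\<close>

lemma graph_dist_sym:
  assumes "pair_graph G"
  shows "graph_dist G u v = graph_dist G v u"
proof -
  interpret pair_graph G by fact
  have cost: "awalk_cost (\<lambda>_. 1) (rev_path p) = awalk_cost (\<lambda>_. 1) p" for p :: "('a \<times> 'a) list"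
    by (induction p) auto
  have "graph_dist G a b \<le> graph_dist G b a" for a b
    unfolding graph_dist_def \<mu>_def
    by (rule INF_mono) (metis (no_types, lifting) awalk_rev_path cost mem_Collect_eq order_refl)
  then show ?thesis by (simp add: antisym)
qed

lemma pair_graph_graph_power:
  assumes "pair_graph G"
  shows "pair_graph (graph_power G k)"
proof -
  interpret pair_graph G by fact
  have fin: "finite (parcs (graph_power G k))"
    by (rule finite_subset[of _ "pverts G \<times> pverts G"])
      (use pair_finite_verts in \<open>auto simp: graph_power_def\<close>)
  show ?thesis
    using fin pair_finite_verts graph_dist_sym[OF assms]
    by unfold_locales (auto simp: graph_power_def symmetric_def sym_def)
qed

lemma pair_graph_strong_power:
  assumes "pair_graph H"
  shows "pair_graph (strong_power H m)"
proof -
  interpret pair_graph H by fact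
  have finV: "finite (pverts (strong_power H m))"
    using finite_lists_length_eq[OF pair_finite_verts, of m]
    by (simp add: strong_power_def conj_commute)
  have fin: "finite (parcs (strong_power H m))"
    by (rule finite_subset[OF _ finite_cartesian_product[OF finV finV]])
      (auto simp: strong_power_def Let_def)
  show ?thesis
    using fin finV
    by unfold_locales
      (auto simp: strong_power_def Let_def symmetric_def sym_def dest: arcs_symmetric; metis arcs_symmetric)+
qed

lemma independent_sets_finite_nonempty:
  assumes "pair_graph G"
  shows "finite {S. independent_set G S}" "{S. independent_set G S} \<noteq> {}"
    "finite {S. k_independent_set k G S}" "{S. k_independent_set k G S} \<noteq> {}"
proof -
  interpret pair_graph G by fact
  have fin: "finite (Pow (pverts G))" using pair_finite_verts by simp
  show "finite {S. independent_set G S}" "finite {S. k_independent_set k G S}"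
    by (rule finite_subset[OF _ fin], auto simp: independent_set_def k_independent_set_def)+
  have "independent_set G {}" "k_independent_set k G {}"
    by (auto simp: independent_set_def k_independent_set_def)
  then show "{S. independent_set G S} \<noteq> {}" "{S. k_independent_set k G S} \<noteq> {}"
    by blast+
qed

lemma independence_number_le_card:
  assumes "pair_graph G"
  shows "independence_number G \<le> card (pverts G)"
proof -
  interpret pair_graph G by fact
  show ?thesis
    unfolding independence_number_def
  proof (rule Max.boundedI)
    fix a assume "a \<in> card ` {S. independent_set G S}"
    then show "a \<le> card (pverts G)"
      using pair_finite_verts by (auto simp: independent_set_def intro: card_mono)
  qed (use independent_sets_finite_nonempty(1,2)[OF assms] in simp_all)
qed

lemma shannon_capacity_bdd_above:
  assumes "pair_graph H"
  shows "bdd_above ((\<lambda>m. root m (real (independence_number (strong_power H m)))) ` {1..})"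
proof (rule bdd_aboveI2)
  fix m :: nat assume m: "m \<in> {1..}"
  interpret pair_graph H by fact
  have "card (pverts (strong_power H m)) = card (pverts H) ^ m"
    using card_lists_length_eq[OF pair_finite_verts, of m]
    by (simp add: strong_power_def conj_commute)
  then have "independence_number (strong_power H m) \<le> card (pverts H) ^ m"
    using independence_number_le_card[OF pair_graph_strong_power[OF assms]] by metis
  then have "root m (real (independence_number (strong_power H m))) \<le> root m (real (card (pverts H)) ^ m)"
    using m by (intro real_root_le_mono) (auto simp flip: of_nat_power)
  also have "\<dots> = real (card (pverts H))"
    using m by (simp add: real_root_power_cancel)
  finally show "root m (real (independence_number (strong_power H m))) \<le> real (card (pverts H))" .
qed

lemma rank_set_finite_nonempty:
  fixes A :: "real^'n^'n" and k :: nat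
  defines "P \<equiv> {p. degree p \<le> k \<and> (\<forall>i. poly_matrix p A $ i $ i \<noteq> 0)}"
  shows "P \<noteq> {}" "finite ((\<lambda>p. rank (poly_matrix p A)) ` P)"
proof -
  have "1 \<in> P" by (simp add: P_def poly_matrix_def mat_def)
  then show "P \<noteq> {}" by blast
  show "finite ((\<lambda>p. rank (poly_matrix p A)) ` P)"
    by (rule finite_subset[of _ "{..CARD('n)}"]) (use rank_bound in \<open>force\<close>)+
qed

end

theory Submission
  imports Defs "HOL-Library.Function_Algebras"
begin

text \<open>
  The upper bound is Haemers' rank argument. Let \<open>M = p(A)\<close>. A nonzero entry \<open>(u, v)\<close> of \<open>A\<^sup>i\<close>
  yields a walk of length \<open>i\<close>, so \<open>M\<close> has nonzero diagonal and vanishes at distinct vertices that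
  are nonadjacent in \<open>G\<^sup>k\<close>. On an independent set of the \<open>m\<close>-fold strong product, the
  \<open>m\<close>-fold Kronecker power of \<open>M\<close> is therefore a nonsingular diagonal matrix. Its rank is at most
  \<open>(rank M)\<^sup>m\<close>, because a factorization of \<open>M\<close> through a space of dimension \<open>rank M\<close> can be
  raised to the \<open>m\<close>-th Kronecker power.
\<close>

definition rank_at_most :: "nat \<Rightarrow> ('a \<Rightarrow> 'b \<Rightarrow> 'c::comm_semiring_1) \<Rightarrow> bool" where
  "rank_at_most r D \<longleftrightarrow> (\<exists>f g. \<forall>x y. D x y = (\<Sum>t<r. f x t * g t y))"

lemma rank_at_most_card:
  assumes "finite T" and "\<And>x y. D x y = (\<Sum>t\<in>T. f x t * g t y)"
  shows "rank_at_most (card T) D"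
proof -
  obtain h where h: "bij_betw h {..<card T} T"
    using ex_bij_betw_nat_finite[OF \<open>finite T\<close>] by (auto simp: lessThan_atLeast0)
  have "D x y = (\<Sum>j<card T. f x (h j) * g (h j) y)" for x y
    unfolding assms(2) by (rule sum.reindex_bij_betw[OF h, symmetric])
  then show ?thesis
    unfolding rank_at_most_def by (intro exI allI)
qed

lemma rank_at_most_rank:
  fixes M :: "'a::field^'n^'m"
  shows "rank_at_most (rank M) (\<lambda>i j. M $ i $ j)"
proof -
  obtain B where B: "vec.independent B" "rows M \<subseteq> vec.span B" "card B = rank M"
    using vec.basis_exists[of "rows M"] by (metis row_rank_def_gen)
  have finite_B: "finite B"
    using B(1) by (rule vec.finiteI_independent)
  have "\<exists>c. row i M = (\<Sum>b\<in>B. c b *s b)" for i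
    using B(2) vec.span_finite[OF finite_B] by (auto simp: rows_def)
  then obtain c where c: "row i M = (\<Sum>b\<in>B. c i b *s b)" for i
    by metis
  have "M $ i $ j = (\<Sum>b\<in>B. c i b * b $ j)" for i j
    using arg_cong[OF c[of i], of "\<lambda>v. v $ j"] by (simp add: row_def)
  then have "rank_at_most (card B) (\<lambda>i j. M $ i $ j)"
    by (rule rank_at_most_card[OF finite_B])
  then show ?thesis
    by (simp add: B(3))
qed

definition kronecker_power :: "nat \<Rightarrow> ('a \<Rightarrow> 'b \<Rightarrow> 'c::comm_monoid_mult) \<Rightarrow> 'a list \<Rightarrow> 'b list \<Rightarrow> 'c" where
  "kronecker_power m D xs ys = (\<Prod>i<m. D (xs ! i) (ys ! i))"

lemma rank_at_most_kronecker_power: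
  assumes "rank_at_most r D"
  shows "rank_at_most (r ^ m) (kronecker_power m D)"
proof -
  obtain f g where D: "D x y = (\<Sum>t<r. f x t * g t y)" for x y
    using assms unfolding rank_at_most_def by blast
  let ?T = "\<Pi>\<^sub>E i\<in>{..<m}. {..<r}"
  have "kronecker_power m D xs ys = (\<Sum>t\<in>?T. (\<Prod>i<m. f (xs ! i) (t i)) * (\<Prod>i<m. g (t i) (ys ! i)))"
    for xs ys
    by (simp add: kronecker_power_def D prod_sum_PiE prod.distrib)
  moreover have "finite ?T"
    by (simp add: finite_PiE)
  ultimately have "rank_at_most (card ?T) (kronecker_power m D)"
    by (rule rank_at_most_card[rotated])
  then show ?thesis
    by (simp add: card_PiE)
qed

interpretation fun_space: vector_space "\<lambda>(c::'b::field) (f::'a \<Rightarrow> 'b) x. c * f x"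
  by unfold_locales (auto simp: fun_eq_iff algebra_simps)

lemma sum_fun_apply: "(\<Sum>t\<in>T. f t) x = (\<Sum>t\<in>T. f t x)"
  by (induction T rule: infinite_finite_induct) auto

lemma
  fixes D :: "'a \<Rightarrow> 'a \<Rightarrow> 'b::field"
  assumes diag: "\<And>s. s \<in> S \<Longrightarrow> D s s \<noteq> 0"
    and off_diag: "\<And>s s'. s \<in> S \<Longrightarrow> s' \<in> S \<Longrightarrow> s \<noteq> s' \<Longrightarrow> D s s' = 0"
  shows inj_on_rows_of_diagonal: "inj_on D S"
    and independent_rows_of_diagonal: "fun_space.independent (D ` S)"
proof -
  show "inj_on D S"
    by (rule inj_onI) (metis diag off_diag)
  show "fun_space.independent (D ` S)"
    unfolding fun_space.dependent_def
  proof safe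
    fix s assume s: "s \<in> S" and "D s \<in> fun_space.span (D ` S - {D s})"
    moreover have "fun_space.span (D ` S - {D s}) \<subseteq> {f. f s = 0}"
      using s by (intro fun_space.span_minimal) (auto simp: fun_space.subspace_def intro!: off_diag)
    ultimately show False
      using diag by auto
  qed
qed

lemma card_le_if_rank_at_most_diagonal:
  fixes D :: "'a \<Rightarrow> 'a \<Rightarrow> 'b::field"
  assumes "rank_at_most r D"
    and diag: "\<And>s. s \<in> S \<Longrightarrow> D s s \<noteq> 0"
    and off_diag: "\<And>s s'. s \<in> S \<Longrightarrow> s' \<in> S \<Longrightarrow> s \<noteq> s' \<Longrightarrow> D s s' = 0"
  shows "card S \<le> r"
proof -
  obtain f g where D: "D x y = (\<Sum>t<r. f x t * g t y)" for x y
    using assms(1) unfolding rank_at_most_def by blast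
  have "(\<Sum>t<r. (\<lambda>y. f x t * g t y)) \<in> fun_space.span (g ` {..<r})" for x
    by (intro fun_space.span_sum fun_space.span_scale fun_space.span_base imageI)
  moreover have "(\<Sum>t<r. (\<lambda>y. f x t * g t y)) = D x" for x
    by (simp add: fun_eq_iff sum_fun_apply D)
  ultimately have "D ` S \<subseteq> fun_space.span (g ` {..<r})"
    by (metis image_subsetI)
  then have "card (D ` S) \<le> card (g ` {..<r})"
    using fun_space.independent_span_bound independent_rows_of_diagonal[of S D] diag off_diag by blast
  also have "\<dots> \<le> r"
    using card_image_le[of "{..<r}" g] by simp
  finally show ?thesis
    using card_image[OF inj_on_rows_of_diagonal[of S D]] diag off_diag by simp
qed

definition fits_graph :: "('a \<Rightarrow> 'a \<Rightarrow> 'b::zero) \<Rightarrow> 'a pair_pre_digraph \<Rightarrow> bool" where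
  "fits_graph D H \<longleftrightarrow> (\<forall>u\<in>pverts H. D u u \<noteq> 0) \<and>
     (\<forall>u\<in>pverts H. \<forall>v\<in>pverts H. u \<noteq> v \<longrightarrow> (u, v) \<notin> parcs H \<longrightarrow> D u v = 0)"

lemma fits_graph_kronecker_power:
  fixes D :: "'a \<Rightarrow> 'a \<Rightarrow> 'b::semidom"
  assumes fits: "fits_graph D H"
  shows "fits_graph (kronecker_power m D) (strong_power H m)"
  unfolding fits_graph_def
proof (intro conjI ballI impI)
  fix xs assume "xs \<in> pverts (strong_power H m)"
  then have "xs ! i \<in> pverts H" if "i < m" for i
    using that by (auto simp: strong_power_def Let_def)
  then show "kronecker_power m D xs xs \<noteq> 0"
    using fits by (simp add: kronecker_power_def fits_graph_def)
next
  fix xs ys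
  assume words: "xs \<in> pverts (strong_power H m)" "ys \<in> pverts (strong_power H m)"
    and "xs \<noteq> ys" "(xs, ys) \<notin> parcs (strong_power H m)"
  then obtain i where i: "i < m" "xs ! i \<noteq> ys ! i" "(xs ! i, ys ! i) \<notin> parcs H"
    by (auto simp: strong_power_def Let_def)
  moreover have "xs ! i \<in> pverts H" "ys ! i \<in> pverts H"
    using words i(1) by (auto simp: strong_power_def Let_def)
  ultimately have "D (xs ! i) (ys ! i) = 0"
    using fits by (simp add: fits_graph_def)
  then show "kronecker_power m D xs ys = 0"
    using i(1) by (auto simp: kronecker_power_def)
qed

lemma obtains_maximum_independent_set:
  assumes "pair_graph H"
  obtains S where "independent_set H S" and "card S = independence_number H"
  using obtains_MAX[OF independent_sets_finite_nonempty(1,2)[OF assms], of card]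
  unfolding independence_number_def by (metis mem_Collect_eq)

lemma card_le_independence_number:
  assumes "pair_graph H" and "independent_set H S"
  shows "card S \<le> independence_number H"
  unfolding independence_number_def
  using independent_sets_finite_nonempty(1)[OF assms(1)] assms(2) by (intro Max_ge) auto

lemma independence_number_le_if_fits_graph:
  fixes D :: "'a \<Rightarrow> 'a \<Rightarrow> 'b::field"
  assumes "pair_graph H" and fits: "fits_graph D H" and "rank_at_most r D"
  shows "independence_number H \<le> r"
proof -
  obtain S where S: "independent_set H S" "card S = independence_number H"
    using obtains_maximum_independent_set[OF \<open>pair_graph H\<close>] .
  have "S \<subseteq> pverts H"
    using S(1) by (simp add: independent_set_def)
  then have "D s s \<noteq> 0" if "s \<in> S" for s
    using fits that by (auto simp: fits_graph_def)
  moreover have "D s s' = 0" if "s \<in> S" "s' \<in> S" "s \<noteq> s'" for s s'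
    using fits S(1) that by (auto simp: fits_graph_def independent_set_def subset_iff)
  ultimately have "card S \<le> r"
    by (rule card_le_if_rank_at_most_diagonal[OF \<open>rank_at_most r D\<close>])
  then show ?thesis
    by (simp add: S(2))
qed

theorem shannon_capacity_le_if_fits_graph:
  fixes D :: "'a \<Rightarrow> 'a \<Rightarrow> 'b::field"
  assumes H: "pair_graph H" and fits: "fits_graph D H" and rank: "rank_at_most r D"
  shows "shannon_capacity H \<le> real r"
  unfolding shannon_capacity_def
proof (rule cSUP_least)
  fix m :: nat assume m: "m \<in> {1..}"
  have "independence_number (strong_power H m) \<le> r ^ m"
    using pair_graph_strong_power[OF H] fits_graph_kronecker_power[OF fits]
      rank_at_most_kronecker_power[OF rank]
    by (rule independence_number_le_if_fits_graph)
  then have "root m (real (independence_number (strong_power H m))) \<le> root m (real r ^ m)"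
    using m by (intro real_root_le_mono) (auto simp flip: of_nat_power)
  also have "\<dots> = real r"
    using m by (simp add: real_root_power_cancel)
  finally show "root m (real (independence_number (strong_power H m))) \<le> real r" .
qed simp

lemma independent_set_strong_power:
  assumes "independent_set H S"
  shows "independent_set (strong_power H m) {xs. set xs \<subseteq> S \<and> length xs = m}"
  unfolding independent_set_def
proof (intro conjI ballI impI)
  show "{xs. set xs \<subseteq> S \<and> length xs = m} \<subseteq> pverts (strong_power H m)"
    using assms by (auto simp: independent_set_def strong_power_def Let_def)
next
  fix xs ys
  assume words: "xs \<in> {xs. set xs \<subseteq> S \<and> length xs = m}" "ys \<in> {xs. set xs \<subseteq> S \<and> length xs = m}"
    and "xs \<noteq> ys"
  then obtain i where i: "i < m" "xs ! i \<noteq> ys ! i"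
    by (auto simp: list_eq_iff_nth_eq)
  moreover have "xs ! i \<in> S" "ys ! i \<in> S"
    using words i(1) by auto
  ultimately have "(xs ! i, ys ! i) \<notin> parcs H"
    using assms by (auto simp: independent_set_def)
  then show "(xs, ys) \<notin> parcs (strong_power H m)"
    using i by (auto simp: strong_power_def Let_def)
qed

lemma independence_number_power_le_strong_power:
  assumes H: "pair_graph H"
  shows "independence_number H ^ m \<le> independence_number (strong_power H m)"
proof -
  interpret pair_graph H by fact
  obtain S where S: "independent_set H S" "card S = independence_number H"
    using obtains_maximum_independent_set[OF H] .
  have "finite S"
    using S(1) pair_finite_verts by (auto simp: independent_set_def intro: finite_subset)
  then have "independence_number H ^ m = card {xs. set xs \<subseteq> S \<and> length xs = m}"
    by (simp add: card_lists_length_eq S(2))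
  also have "\<dots> \<le> independence_number (strong_power H m)"
    using pair_graph_strong_power[OF H] independent_set_strong_power[OF S(1)]
    by (rule card_le_independence_number)
  finally show ?thesis .
qed

lemma independence_number_le_shannon_capacity:
  assumes H: "pair_graph H"
  shows "real (independence_number H) \<le> shannon_capacity H"
proof -
  have "real (independence_number H) \<le> root 1 (real (independence_number (strong_power H 1)))"
    using independence_number_power_le_strong_power[OF H, of 1] by simp
  also have "\<dots> \<le> shannon_capacity H"
    unfolding shannon_capacity_def
    by (rule cSUP_upper[OF _ shannon_capacity_bdd_above[OF H]]) simp
  finally show ?thesis .
qed

lemma k_independent_set_iff_independent_set_graph_power:
  "k_independent_set k G S \<longleftrightarrow> independent_set (graph_power G k) S"
  by (auto simp: k_independent_set_def independent_set_def graph_power_def not_le)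

lemma k_independence_number_eq_independence_number_graph_power:
  "k_independence_number k G = independence_number (graph_power G k)"
  by (simp add: k_independence_number_def independence_number_def
      k_independent_set_iff_independent_set_graph_power)

lemma (in pair_wf_digraph) graph_dist_le_length_awalk:
  assumes "awalk u p v"
  shows "graph_dist G u v \<le> ereal (real (length p))"
proof -
  have "awalk_cost (\<lambda>_. 1) p = real (length p)"
    by (induction p) auto
  then show ?thesis
    using min_cost_le_walk_cost[OF assms, of "\<lambda>_. 1"] by (simp add: graph_dist_def)
qed

lemma graph_dist_le_if_matrix_power_nonzero:
  fixes G :: "'n::finite pair_pre_digraph" and A :: "real^'n^'n"
  assumes "pair_wf_digraph G"
    and support: "\<And>u v. A $ u $ v \<noteq> 0 \<Longrightarrow> (u, v) \<in> parcs G"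
    and "v \<in> pverts G" and "matrix_power A i $ u $ v \<noteq> 0"
  shows "graph_dist G u v \<le> ereal (real i)"
proof -
  interpret pair_wf_digraph G by fact
  have "\<exists>p. awalk u p v \<and> length p = i"
    using \<open>matrix_power A i $ u $ v \<noteq> 0\<close>
  proof (induction i arbitrary: u)
    case 0
    then have "u = v"
      by (auto simp: mat_def split: if_splits)
    then show ?case
      using \<open>v \<in> pverts G\<close> by (auto simp: awalk_Nil_iff)
  next
    case (Suc i)
    then obtain w where "A $ u $ w \<noteq> 0" and w: "matrix_power A i $ w $ v \<noteq> 0"
      by (auto simp: matrix_matrix_mult_def elim!: sum.not_neutral_contains_not_neutral)
    then have "(u, w) \<in> parcs G"
      by (intro support)
    moreover obtain p where "awalk w p v" "length p = i"
      using Suc.IH[OF w] by blast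
    ultimately have "awalk u ((u, w) # p) v \<and> length ((u, w) # p) = Suc i"
      by (auto simp: awalk_Cons_iff)
    then show ?case
      by blast
  qed
  then obtain p where "awalk u p v" "length p = i"
    by blast
  then show ?thesis
    using graph_dist_le_length_awalk[of u p v] by simp
qed

lemma fits_graph_poly_matrix_graph_power:
  fixes G :: "'n::finite pair_pre_digraph" and A :: "real^'n^'n"
  assumes G: "pair_wf_digraph G"
    and support: "\<And>u v. A $ u $ v \<noteq> 0 \<Longrightarrow> (u, v) \<in> parcs G"
    and "degree p \<le> k" and diag: "\<And>u. u \<in> pverts G \<Longrightarrow> poly_matrix p A $ u $ u \<noteq> 0"
  shows "fits_graph (\<lambda>u v. poly_matrix p A $ u $ v) (graph_power G k)"
proof -
  have "poly_matrix p A $ u $ v = 0"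
    if uv: "u \<in> pverts G" "v \<in> pverts G" "u \<noteq> v" "(u, v) \<notin> parcs (graph_power G k)" for u v
  proof -
    have "matrix_power A i $ u $ v = 0" if "i \<le> degree p" for i
    proof (rule ccontr)
      assume "matrix_power A i $ u $ v \<noteq> 0"
      then have "graph_dist G u v \<le> ereal (real i)"
        by (intro graph_dist_le_if_matrix_power_nonzero[OF G support uv(2)])
      also have "\<dots> \<le> ereal (real k)"
        using \<open>i \<le> degree p\<close> \<open>degree p \<le> k\<close> by simp
      finally show False
        using uv by (simp add: graph_power_def)
    qed
    then show ?thesis
      by (simp add: poly_matrix_def)
  qed
  then show ?thesis
    using diag unfolding fits_graph_def by (auto simp: graph_power_def)
qed

theorem theorem4p2:
  fixes G :: "'n::finite pair_pre_digraph" and A :: "real^'n^'n" and k :: nat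
  assumes "pair_graph G"
    and "pverts G = UNIV"
    and "Digraph_Component.connected (with_proj G)"
    and "A = adjacency_matrix G"
    and "k > 0"
  shows "k_independence_number k G = independence_number (graph_power G k)
    \<and> real (independence_number (graph_power G k)) \<le> shannon_capacity (graph_power G k)
    \<and> shannon_capacity (graph_power G k)
        \<le> real (MIN p\<in>{p. degree p \<le> k \<and> (\<forall>i. poly_matrix p A $ i $ i \<noteq> 0)}. rank (poly_matrix p A))"
proof -
  interpret pair_graph G by fact
  let ?P = "{p. degree p \<le> k \<and> (\<forall>i. poly_matrix p A $ i $ i \<noteq> 0)}"
  have pair_graph_power: "pair_graph (graph_power G k)"
    using \<open>pair_graph G\<close> by (rule pair_graph_graph_power)
  have "(MIN p\<in>?P. rank (poly_matrix p A)) \<in> (\<lambda>p. rank (poly_matrix p A)) ` ?P"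
    using rank_set_finite_nonempty[where A = A and k = k] by (intro Min_in) auto
  then obtain p where p: "p \<in> ?P" "(MIN p\<in>?P. rank (poly_matrix p A)) = rank (poly_matrix p A)"
    by blast
  have "A $ u $ v \<noteq> 0 \<Longrightarrow> (u, v) \<in> parcs G" for u v
    by (simp add: \<open>A = adjacency_matrix G\<close> adjacency_matrix_def split: if_splits)
  then have "fits_graph (\<lambda>u v. poly_matrix p A $ u $ v) (graph_power G k)"
    using p(1) by (intro fits_graph_poly_matrix_graph_power[OF pair_wf_digraph_axioms]) simp_all
  then have "shannon_capacity (graph_power G k) \<le> real (rank (poly_matrix p A))"
    by (rule shannon_capacity_le_if_fits_graph[OF pair_graph_power _ rank_at_most_rank])
  then show ?thesis
    unfolding p(2)
    using k_independence_number_eq_independence_number_graph_power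
      independence_number_le_shannon_capacity[OF pair_graph_power] by blast
qed

end
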